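(* $R(Q_2, Q_3) = 5$.
   Context: $Q_k$ denotes the Boolean lattice of dimension $k$: the family of all subsets of a $k$-element ground set (e.g. $[k]=\{1,\dots,k\}$), ordered by inclusion. A subposet $Q'$ of a poset $Q$ is a copy of a poset $P$ if there is a bijection $f$ from $P$ to $Q'$ such that $x \le y$ in $P$ if and only if $f(x) \le f(y)$ in $Q$. For posets $P, P'$, the poset Ramsey number $R(P,P')$ is the smallest integer $N$ such that for every coloring of the elements of $Q_N$ in red and blue, there is a copy of $P$ all of whose elements are red or a copy of $P'$ all of whose elements are blue. *)

theory Defs
  imports Main
begin

text \<open>
  A poset is represented by a carrier set in a type of class \<open>order\<close>, with the induced order.
  On \<open>nat set\<close> the class order is inclusion.
\<close>

definition boolean_lattice :: "nat \<Rightarrow> nat set set" where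
  "boolean_lattice k = Pow {1..k}"

definition is_copy :: "'a::order set \<Rightarrow> 'b::order set \<Rightarrow> bool" where
  "is_copy P Q' \<longleftrightarrow>
    (\<exists>f. bij_betw f P Q' \<and> (\<forall>x\<in>P. \<forall>y\<in>P. x \<le> y \<longleftrightarrow> f x \<le> f y))"

datatype color = Red | Blue

definition poset_arrows :: "nat \<Rightarrow> 'a::order set \<Rightarrow> 'b::order set \<Rightarrow> bool" where
  "poset_arrows N P P' \<longleftrightarrow>
    (\<forall>c :: nat set \<Rightarrow> color.
      (\<exists>S \<subseteq> boolean_lattice N. is_copy P S \<and> (\<forall>x\<in>S. c x = Red)) \<or>
      (\<exists>S \<subseteq> boolean_lattice N. is_copy P' S \<and> (\<forall>x\<in>S. c x = Blue)))"

text \<open>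
  On \<open>nat\<close>, \<open>Inf\<close> of a nonempty set is its least element, and \<open>Inf {} = 0\<close>. Hence
  an equation with a positive right-hand side also asserts that such an \<open>N\<close> exists.
\<close>

definition poset_ramsey :: "'a::order set \<Rightarrow> 'b::order set \<Rightarrow> nat" where
  "poset_ramsey P P' = Inf {N. poset_arrows N P P'}"

end

theory Submission
  imports Defs
begin

text \<open>
  Lower bound: in \<open>Q\<^sub>4\<close> colour the two lowest layers red and the other three blue. A copy of
  \<open>Q\<^sub>k\<close> contains a chain of \<open>k + 1\<close> sets, which does not fit into \<open>k\<close> layers.

  Upper bound: suppose a colouring of \<open>Q\<^sub>5\<close>, with ground set \<open>V\<close>, has neither copy. If
  \<open>V\<close> is blue, \<open>x \<in> V\<close>, and both a red and a blue set occur among \<open>{}\<close> and \<open>{x}\<close>, then among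
  the sets containing \<open>x\<close> (other than \<open>{x}\<close> and \<open>V\<close>) there are no two incomparable red sets
  with a red upper bound, and the blue ones contain no crown (the two middle layers of
  \<open>Q\<^sub>3\<close>). Up to relabelling, only one colouring of the proper nonempty subsets of
  a 4-set has these two properties: singletons blue, triples red, and the red pairs form a perfect
  matching. That colouring forces a blue \<open>Q\<^sub>3\<close> once sets that avoid \<open>x\<close> are also used. Up to
  complementation this leaves two cases: \<open>{}\<close> and \<open>V\<close> are both red, or they are both blue together with all
  singletons and their complements; either case contains a blue \<open>Q\<^sub>3\<close>.
\<close>

section \<open>Forced colourings of the subsets of a 4-set\<close>

definition matching_coloring :: "('a set \<Rightarrow> bool) \<Rightarrow> 'a \<Rightarrow> 'a \<Rightarrow> 'a \<Rightarrow> 'a \<Rightarrow> bool" where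
  "matching_coloring red a b c d \<longleftrightarrow>
    distinct [a, b, c, d] \<and>
    \<not> red {a} \<and> \<not> red {b} \<and> \<not> red {c} \<and> \<not> red {d} \<and>
    red {a, b} \<and> red {c, d} \<and>
    \<not> red {a, c} \<and> \<not> red {a, d} \<and> \<not> red {b, c} \<and> \<not> red {b, d} \<and>
    red {a, b, c} \<and> red {a, b, d} \<and> red {a, c, d} \<and> red {b, c, d}"

lemma matching_coloring_swap:
  assumes "matching_coloring red a b c d"
  shows "matching_coloring red b a c d" "matching_coloring red c d a b"
  using assms by (auto simp: matching_coloring_def insert_commute)

text \<open>In the application \<open>G\<close> is \<open>V - {x}\<close> and \<open>red X\<close>
  is the colour of \<open>insert x X\<close>. A red set within \<open>{x}\<close> supplies the
  bottom of a red square; a blue one, together with a blue \<open>V\<close>, completes a crown to a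
  blue Q_3.\<close>

locale crown_free =
  fixes G :: "'a set" and red :: "'a set \<Rightarrow> bool"
  assumes red_join: "\<lbrakk>\<not> B \<subseteq> C; \<not> C \<subseteq> B; B \<subseteq> D; C \<subseteq> D; D \<subseteq> G; red B; red C\<rbrakk> \<Longrightarrow> \<not> red D"
    and blue_crown: "\<lbrakk>A1 \<subseteq> B12; A2 \<subseteq> B12; A1 \<subseteq> B13; A3 \<subseteq> B13; A2 \<subseteq> B23; A3 \<subseteq> B23;
      \<not> A1 \<subseteq> B23; \<not> A2 \<subseteq> B13; \<not> A3 \<subseteq> B12; B12 \<subseteq> G; B13 \<subseteq> G; B23 \<subseteq> G\<rbrakk> \<Longrightarrow>
      red A1 \<or> red A2 \<or> red A3 \<or> red B12 \<or> red B13 \<or> red B23"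
begin

text \<open>Every subset of \<open>G\<close> that contains both red points is blue. Whatever colours
  \<open>{a}\<close> and \<open>{b}\<close> have, further joins are forced blue until a blue crown
  appears.\<close>

lemma red_singletons_unique:
  assumes G: "G = {a, b, c, d}" "distinct [a, b, c, d]" and red: "red {c}" "red {d}"
  shows False
proof -
  have cd: "\<not> red {c, d}" "\<not> red {a, c, d}" "\<not> red {b, c, d}"
    using red_join[of "{c}" "{d}"] G red by auto
  consider "\<not> red {a}" "\<not> red {b}" | "\<not> red {a}" "red {b}" | "red {a}" "\<not> red {b}" | "red {a}" "red {b}"
    by blast
  then show False
  proof cases
    case 1
    have "red {a, b}"
      using blue_crown[of "{a}" "{a, b}" "{b}" "{a, c, d}" "{c, d}" "{b, c, d}"] G cd 1 by auto
    then have "\<not> red {a, b, c}"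
      using red_join[of "{a, b}" "{c}" "{a, b, c}"] G red by auto
    then show False
      using blue_crown[of "{a}" "{a, b, c}" "{b}" "{a, c, d}" "{c, d}" "{b, c, d}"] G cd 1 by auto
  next
    case 2
    have "\<not> red {b, c}" "\<not> red {b, d}" "\<not> red {a, b, c}" "\<not> red {a, b, d}"
      using red_join[of "{b}" "{c}"] red_join[of "{b}" "{d}"] G red 2 by auto
    then show False
      using blue_crown[of "{a}" "{a, b, c}" "{b, c}" "{a, b, d}" "{b, d}" "{b, c, d}"] G cd 2 by auto
  next
    case 3
    have "\<not> red {a, c}" "\<not> red {a, d}" "\<not> red {a, b, c}" "\<not> red {a, b, d}"
      using red_join[of "{a}" "{c}"] red_join[of "{a}" "{d}"] G red 3 by auto
    then show False
      using blue_crown[of "{b}" "{a, b, c}" "{a, c}" "{a, b, d}" "{a, d}" "{a, c, d}"] G cd 3 by auto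
  next
    case 4
    have "\<not> red {a, b}" "\<not> red {a, c}" "\<not> red {a, d}" "\<not> red {a, b, c}" "\<not> red {a, b, d}"
      using red_join[of "{a}" "{b}"] red_join[of "{a}" "{c}"] red_join[of "{a}" "{d}"] G red 4 by auto
    then show False
      using blue_crown[of "{a, b}" "{a, b, c}" "{a, c}" "{a, b, d}" "{a, d}" "{a, c, d}"] G cd 4 by auto
  qed
qed

lemma matching_coloring_if_red_pair:
  assumes G: "G = {a, b, c, d}" "distinct [a, b, c, d]"
    and abc: "\<not> red {a}" "\<not> red {b}" "\<not> red {c}"
    and red: "red {a, b}" "red {a, b, d}"
  shows "matching_coloring red a b c d"
proof -
  have d: "\<not> red {d}" "\<not> red {a, d}" "\<not> red {b, d}"
    using red_join[of "{a, b}" "{d}" "{a, b, d}"] red_join[of "{a, b}" "{a, d}" "{a, b, d}"]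
      red_join[of "{a, b}" "{b, d}" "{a, b, d}"] G red by auto
  \<comment> \<open>So \<open>{a}\<close> and \<open>{c}\<close> have a blue upper bound avoiding
    \<open>d\<close>, and so do \<open>{b}\<close> and \<open>{c}\<close>. With either choice of it,
    the last set of the crown must be red.\<close>
  have "\<not> (red {a, c} \<and> red {a, b, c})" "\<not> (red {b, c} \<and> red {a, b, c})"
    using red_join[of "{a, b}" "{a, c}" "{a, b, c}"]
      red_join[of "{a, b}" "{b, c}" "{a, b, c}"] G red by auto
  then have cd: "red {c, d}" "red {b, c, d}" "red {a, c, d}"
    using blue_crown[of "{a}" "{a, c}" "{c}" "{a, d}" "{d}" "{c, d}"]
      blue_crown[of "{a}" "{a, b, c}" "{c}" "{a, d}" "{d}" "{c, d}"]
      blue_crown[of "{a}" "{a, c}" "{c}" "{a, d}" "{d}" "{b, c, d}"]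
      blue_crown[of "{a}" "{a, b, c}" "{c}" "{a, d}" "{d}" "{b, c, d}"]
      blue_crown[of "{b}" "{b, c}" "{c}" "{b, d}" "{d}" "{a, c, d}"]
      blue_crown[of "{b}" "{a, b, c}" "{c}" "{b, d}" "{d}" "{a, c, d}"]
      G abc d by auto
  have c: "\<not> red {a, c}" "\<not> red {b, c}"
    using red_join[of "{c, d}" "{a, c}" "{a, c, d}"] red_join[of "{c, d}" "{b, c}" "{b, c, d}"] G cd
    by auto
  have "red {a, b, c}"
    using blue_crown[of "{a}" "{a, b, c}" "{b}" "{a, d}" "{d}" "{b, d}"] G abc d by auto
  then show ?thesis
    using G abc d cd c red by (simp add: matching_coloring_def)
qed

text \<open>Each upper set of a crown on \<open>{a}\<close>, \<open>{b}\<close>, \<open>{c}\<close>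
  may include \<open>d\<close> or not. Hence some pair is red both with and without
  \<open>d\<close>, and \<open>matching_coloring_if_red_pair\<close> applies after
  relabelling.\<close>

lemma ex_matching_coloring_if_blue_singletons:
  assumes G: "G = {a, b, c, d}" "distinct [a, b, c, d]"
    and abc: "\<not> red {a}" "\<not> red {b}" "\<not> red {c}"
  shows "\<exists>p q r s. {p, q, r, s} = G \<and> matching_coloring red p q r s"
proof -
  have "red {a, b} \<and> red {a, b, d} \<or> red {a, c} \<and> red {a, c, d} \<or> red {b, c} \<and> red {b, c, d}"
  proof -
    have "red B12 \<or> red B13 \<or> red B23"
      if "B12 \<in> {{a, b}, {a, b, d}}" "B13 \<in> {{a, c}, {a, c, d}}" "B23 \<in> {{b, c}, {b, c, d}}"
      for B12 B13 B23
      using blue_crown[of "{a}" B12 "{b}" B13 "{c}" B23] G abc that by auto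
    then show ?thesis by blast
  qed
  then consider "red {a, b}" "red {a, b, d}" | "red {a, c}" "red {a, c, d}" | "red {b, c}" "red {b, c, d}"
    by blast
  then show ?thesis
  proof cases
    case 1
    then have "matching_coloring red a b c d"
      by (intro matching_coloring_if_red_pair) (use G abc in auto)
    then show ?thesis using G by blast
  next
    case 2
    then have "matching_coloring red a c b d"
      by (intro matching_coloring_if_red_pair) (use G abc in auto)
    moreover have "{a, c, b, d} = G" using G by auto
    ultimately show ?thesis by blast
  next
    case 3
    then have "matching_coloring red b c a d"
      by (intro matching_coloring_if_red_pair) (use G abc in auto)
    moreover have "{b, c, a, d} = G" using G by auto
    ultimately show ?thesis by blast
  qed
qed

lemma ex_matching_coloring:
  assumes "card G = 4"
  shows "\<exists>p q r s. {p, q, r, s} = G \<and> matching_coloring red p q r s"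
proof -
  have unique: "x = y" if xy: "x \<in> G" "y \<in> G" "red {x}" "red {y}" for x y
  proof (rule ccontr)
    assume "x \<noteq> y"
    then have "card (G - {x, y}) = 2"
      using assms xy by (simp add: card_Diff_subset)
    then obtain a b where "G - {x, y} = {a, b}" "a \<noteq> b"
      by (meson card_2_iff)
    then have "G = {a, b, x, y}" "distinct [a, b, x, y]"
      using xy \<open>x \<noteq> y\<close> by auto
    then show False
      using red_singletons_unique xy by blast
  qed
  \<comment> \<open>\<open>d\<close> is the point of the red singleton if there is one, and any
    point of \<open>G\<close> otherwise.\<close>
  obtain d where d: "d \<in> G" "\<forall>x\<in>G. x \<noteq> d \<longrightarrow> \<not> red {x}"
    using unique assms by (metis card.empty ex_in_conv zero_neq_numeral)
  then have "card (G - {d}) = 3"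
    using assms by simp
  then obtain a b c where "G - {d} = {a, b, c}" "distinct [a, b, c]"
    by (auto simp: card_3_iff)
  then have "G = {a, b, c, d}" "distinct [a, b, c, d]"
    using d(1) by auto
  then show ?thesis
    using d(2) ex_matching_coloring_if_blue_singletons[of a b c d] by auto
qed

end

section \<open>Colourings of the subsets of a 5-set\<close>

lemma card_5_obtain:
  assumes "card V = 5"
  obtains a b c d e where "V = {a, b, c, d, e}" "distinct [a, b, c, d, e]"
proof -
  obtain xs where xs: "set xs = V" "distinct xs"
    using assms by (metis card.infinite finite_distinct_list zero_neq_numeral)
  then have "length xs = 5"
    using assms distinct_card by metis
  then obtain a b c d e where "xs = [a, b, c, d, e]"
    by (auto simp: numeral_eq_Suc length_Suc_conv)
  then show thesis
    using xs that[of a b c d e] by auto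
qed

locale no_mono_copy =
  fixes V :: "'a set" and red :: "'a set \<Rightarrow> bool"
  assumes red_square: "\<lbrakk>A \<subseteq> B; A \<subseteq> C; B \<subseteq> D; C \<subseteq> D;
      \<not> B \<subseteq> C; \<not> C \<subseteq> B; D \<subseteq> V; red A; red B; red C\<rbrakk> \<Longrightarrow> \<not> red D"
    and blue_cube: "\<lbrakk>Z \<subseteq> A1; Z \<subseteq> A2; Z \<subseteq> A3;
      A1 \<subseteq> B12; A2 \<subseteq> B12; A1 \<subseteq> B13; A3 \<subseteq> B13; A2 \<subseteq> B23; A3 \<subseteq> B23;
      B12 \<subseteq> T; B13 \<subseteq> T; B23 \<subseteq> T; \<not> A1 \<subseteq> B23; \<not> A2 \<subseteq> B13; \<not> A3 \<subseteq> B12; T \<subseteq> V\<rbrakk> \<Longrightarrow>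
      red Z \<or> red A1 \<or> red A2 \<or> red A3 \<or> red B12 \<or> red B13 \<or> red B23 \<or> red T"
begin

text \<open>Complementation reverses inclusion, and Q_2 and Q_3 are self-dual. Facts about
  \<open>{}\<close> and singletons thus transfer to \<open>V\<close> and complements of
  singletons.\<close>

lemma dual: "no_mono_copy V (\<lambda>X. red (V - X))"
proof (unfold_locales, goal_cases)
  case (1 A B C D)
  then show ?case
    using red_square[of "V - D" "V - B" "V - C" "V - A"] by blast
next
  case (2 Z A1 A2 A3 B12 B13 B23 T)
  have "B12 \<subseteq> V" "B13 \<subseteq> V" "B23 \<subseteq> V"
    using 2(10-12,16) by auto
  then have "A1 \<subseteq> V" "A2 \<subseteq> V" "A3 \<subseteq> V"
    using 2(4,5,7) by auto
  then have neg: "\<not> V - B23 \<subseteq> V - A1" "\<not> V - B13 \<subseteq> V - A2" "\<not> V - B12 \<subseteq> V - A3"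
    using 2(13-15) by auto
  have "red (V - T) \<or> red (V - B23) \<or> red (V - B13) \<or> red (V - B12) \<or>
    red (V - A3) \<or> red (V - A2) \<or> red (V - A1) \<or> red (V - Z)"
    using 2(1-12) neg by (intro blue_cube Diff_mono order.refl Diff_subset) assumption+
  then show ?case
    by blast
qed

text \<open>
  If both extremes are red, the other red sets form a chain, so for \<open>u \<noteq> v\<close> only one of the
  cubes between \<open>{u}\<close> and \<open>V - {v}\<close> and between \<open>{v}\<close> and \<open>V - {u}\<close> can meet it.
\<close>
lemma extremes_not_both_red:
  assumes V: "card V = 5" and red: "red {}" "red V"
  shows False
proof -
  obtain u v i j k where *: "V = {u, v, i, j, k}" "distinct [u, v, i, j, k]"
    using card_5_obtain[OF V] .
  obtain A where A: "red A" "A \<subseteq> V" "u \<in> A" "v \<notin> A"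
    using blue_cube[of "{u}" "{u, i}" "{u, j}" "{u, k}" "{u, i, j}" "{u, i, k}" "{u, j, k}" "{u, i, j, k}"] *
    by auto
  obtain B where B: "red B" "B \<subseteq> V" "v \<in> B" "u \<notin> B"
    using blue_cube[of "{v}" "{v, i}" "{v, j}" "{v, k}" "{v, i, j}" "{v, i, k}" "{v, j, k}" "{v, i, j, k}"] *
    by auto
  show False
    using red_square[of "{}" A B V] A B red by blast
qed

text \<open>As \<open>R\<close> and \<open>B\<close> differ in colour, they are \<open>{}\<close>
  and \<open>{x}\<close> in some order. Both lie below every set containing \<open>x\<close>, so
  they serve as bottoms of a square and a cube.\<close>

lemma ex_matching_coloring_above:
  assumes "card V = 5" "x \<in> V" "\<not> red V" "R \<subseteq> {x}" "red R" "B \<subseteq> {x}" "\<not> red B"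
  obtains a b c d where "V = {x, a, b, c, d}" "x \<notin> {a, b, c, d}"
    "matching_coloring (\<lambda>X. red (insert x X)) a b c d"
proof -
  interpret crown_free "V - {x}" "\<lambda>X. red (insert x X)"
  proof (unfold_locales, goal_cases)
    case (1 B C D)
    then show ?case
      using red_square[of R "insert x B" "insert x C" "insert x D"] assms by blast
  next
    case (2 A1 B12 A2 B13 A3 B23)
    then show ?case
      using blue_cube[of B "insert x A1" "insert x A2" "insert x A3"
          "insert x B12" "insert x B13" "insert x B23" V] assms by blast
  qed
  have "card (V - {x}) = 4"
    using assms by simp
  from ex_matching_coloring[OF this] show ?thesis
    using that assms(2) by (metis DiffE insert_Diff singletonI)
qed

lemma bottom_not_red:
  assumes V: "card V = 5" "\<not> red V" and red: "red {}"
  shows False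
proof -
  have "\<exists>x\<in>V. \<not> red {x}"
  proof (rule ccontr)
    assume "\<not> ?thesis"
    then have singletons: "red {x}" if "x \<in> V" for x
      using that by blast
    obtain u v i j k where *: "V = {u, v, i, j, k}" "distinct [u, v, i, j, k]"
      using card_5_obtain[OF V(1)] .
    \<comment> \<open>The whole interval from \<open>{u, v}\<close> to \<open>V\<close>, a copy of
      Q_3, becomes blue.\<close>
    have "\<not> red X" if "{u, v} \<subseteq> X" "X \<subseteq> V" for X
      using red_square[of "{}" "{u}" "{v}" X] singletons * red that by auto
    then show False
      using blue_cube[of "{u, v}" "{u, v, i}" "{u, v, j}" "{u, v, k}"
          "{u, v, i, j}" "{u, v, i, k}" "{u, v, j, k}" V] * by auto
  qed
  then obtain x where x: "x \<in> V" "\<not> red {x}"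
    by blast
  obtain a b c d where *: "V = {x, a, b, c, d}" "x \<notin> {a, b, c, d}"
    "matching_coloring (\<lambda>X. red (insert x X)) a b c d"
    by (rule ex_matching_coloring_above[of x "{}" "{x}"]) (use V red x in auto)
  \<comment> \<open>These \<open>X\<close> fill the interval from \<open>{c}\<close> to
    \<open>{x, a, b, c}\<close> except for its red top, which \<open>V\<close> replaces.\<close>
  have "\<not> red X" if "X \<subseteq> {x, a, b, c}" "\<not> X \<subseteq> {x, a, b}" "\<not> {x, a, b} \<subseteq> X" for X
    using red_square[of "{}" "{x, a, b}" X "{x, a, b, c}"] * red that
    by (auto simp: matching_coloring_def)
  then show False
    using blue_cube[of "{c}" "{x, c}" "{a, c}" "{b, c}" "{x, a, c}" "{x, b, c}" "{a, b, c}" V] * V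
    by (auto simp: matching_coloring_def)
qed

text \<open>A red \<open>{a}\<close> would make \<open>{a, c}\<close> and \<open>{a, d}\<close>
  blue, hence \<open>{a, c, d}\<close> red. Then the nonempty subsets of \<open>{c, d}\<close>,
  lying below it and the red \<open>{x, c, d}\<close>, are blue and complete a blue cube.\<close>

lemma blue_singleton_if_matching_coloring:
  assumes V: "V = {x, a, b, c, d}" "x \<notin> {a, b, c, d}" "\<not> red {}" "\<not> red V"
    and m: "matching_coloring (\<lambda>X. red (insert x X)) a b c d"
  shows "\<not> red {a}"
proof
  assume a: "red {a}"
  have b: "\<not> red {a, c}" "\<not> red {a, d}"
    using red_square[of "{a}" "{x, a, b}" "{a, c}" "{x, a, b, c}"]
      red_square[of "{a}" "{x, a, b}" "{a, d}" "{x, a, b, d}"] a V m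
    by (auto simp: matching_coloring_def)
  have "red {a, c, d}"
    using blue_cube[of "{}" "{x, a}" "{a, c}" "{a, d}" "{x, a, c}" "{x, a, d}" "{a, c, d}" V] b V m
    by (auto simp: matching_coloring_def)
  then have "\<not> red X" if "X \<subseteq> {c, d}" "X \<noteq> {}" for X
    using red_square[of X "{x, c, d}" "{a, c, d}" "{x, a, c, d}"] that V m
    by (auto simp: matching_coloring_def)
  then show False
    using blue_cube[of "{}" "{x, a}" "{c}" "{d}" "{x, a, c}" "{x, a, d}" "{c, d}" V] V m
    by (auto simp: matching_coloring_def)
qed

lemma singleton_not_red:
  assumes V: "card V = 5" "\<not> red {}" "\<not> red V" and x: "x \<in> V" "red {x}"
  shows False
proof -
  obtain a b c d where *: "V = {x, a, b, c, d}" "x \<notin> {a, b, c, d}"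
    and m: "matching_coloring (\<lambda>X. red (insert x X)) a b c d"
    by (rule ex_matching_coloring_above[of x "{x}" "{}"]) (use V x in auto)
  \<comment> \<open>Exchanging \<open>a\<close> with \<open>b\<close>, or the pair \<open>a\<close>,
    \<open>b\<close> with \<open>c\<close>, \<open>d\<close>, preserves the matching colouring and
    carries the claim on \<open>{a}\<close> to \<open>{b}\<close> and \<open>{c}\<close>.\<close>
  have "V = {x, b, a, c, d}" "V = {x, c, d, a, b}" "x \<notin> {b, a, c, d}" "x \<notin> {c, d, a, b}"
    using * by auto
  then have abc: "\<not> red {a}" "\<not> red {b}" "\<not> red {c}"
    using blue_singleton_if_matching_coloring * V(2,3) m matching_coloring_swap[OF m] by blast+
  \<comment> \<open>Only \<open>{a, b}\<close> is undecided in this cube. Once red, it makes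
    \<open>{a, b, c}\<close> blue, which takes its place in the final cube; there
    \<open>{x, c}\<close> replaces \<open>{c}\<close> to stay outside
    \<open>{a, b, c}\<close>.\<close>
  have "red {a, b}"
    using blue_cube[of "{}" "{a}" "{b}" "{c}" "{a, b}" "{x, a, c}" "{x, b, c}" V] abc * V m
    by (auto simp: matching_coloring_def)
  then have "\<not> red {a, b, c}"
    using red_square[of "{a, b}" "{x, a, b}" "{a, b, c}" "{x, a, b, c}"] * m
    by (auto simp: matching_coloring_def)
  then show False
    using blue_cube[of "{}" "{a}" "{b}" "{x, c}" "{a, b, c}" "{x, a, c}" "{x, b, c}" V] abc * V m
    by (auto simp: matching_coloring_def)
qed

lemma card_neq_5: "card V \<noteq> 5"
proof
  assume V: "card V = 5"
  interpret dual: no_mono_copy V "\<lambda>X. red (V - X)"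
    by (rule dual)
  have ends: "\<not> red {}" "\<not> red V"
    using extremes_not_both_red bottom_not_red dual.bottom_not_red V by auto
  have singletons: "\<not> red {x}" "\<not> red (V - {x})" if "x \<in> V" for x
    using singleton_not_red dual.singleton_not_red V ends that by auto
  obtain u v w i j where *: "V = {u, v, w, i, j}" "distinct [u, v, w, i, j]"
    using card_5_obtain[OF V] .
  \<comment> \<open>\<open>{w}\<close> and \<open>V - {w}\<close> act as opposite atom and coatom,
    and likewise for \<open>u\<close> and \<open>v\<close>.\<close>
  have "red {} \<or> red {u} \<or> red {v} \<or> red {w} \<or>
    red (V - {w}) \<or> red (V - {v}) \<or> red (V - {u}) \<or> red V"
    by (rule blue_cube) (use * in auto)
  moreover have "u \<in> V" "v \<in> V" "w \<in> V"
    using * by auto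
  ultimately show False
    using ends singletons by blast
qed

end

section \<open>Explicit copies of Q_2 and Q_3, and the upper bound\<close>

lemma is_copy_image:
  fixes f :: "'a::order \<Rightarrow> 'b::order"
  assumes "\<And>x y. x \<in> P \<Longrightarrow> y \<in> P \<Longrightarrow> x \<le> y \<longleftrightarrow> f x \<le> f y"
  shows "is_copy P (f ` P)"
proof -
  have "inj_on f P"
    by (rule inj_onI) (metis assms order.antisym order.refl)
  then show ?thesis
    unfolding is_copy_def using assms by (intro exI[of _ f]) (simp add: inj_on_imp_bij_betw)
qed

lemma is_copy_boolean_lattice_2:
  fixes A B C D :: "'a set"
  assumes "A \<subseteq> B" "A \<subseteq> C" "B \<subseteq> D" "C \<subseteq> D" "\<not> B \<subseteq> C" "\<not> C \<subseteq> B"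
  shows "is_copy (boolean_lattice 2) {A, B, C, D}"
proof -
  define f where "f X = (if 1 \<in> X then if 2 \<in> X then D else B else if 2 \<in> X then C else A)"
    for X :: "nat set"
  have "{1..2::nat} = {1, 2}" by auto
  then have Q: "boolean_lattice 2 = {{}, {1}, {2}, {1, 2}}"
    by (auto simp: boolean_lattice_def Pow_insert)
  have "A \<subseteq> D"
    using assms by blast
  have mono: "f X \<subseteq> f Y" if "X \<subseteq> Y" for X Y
  proof -
    have "i \<in> Y" if "i \<in> X" for i
      using that \<open>X \<subseteq> Y\<close> by blast
    from this[of 1] this[of 2] show ?thesis
      using assms(1-4) \<open>A \<subseteq> D\<close> unfolding f_def by (simp split: if_split)
  qed
  \<comment> \<open>If \<open>i\<close> is in \<open>X\<close> but not in \<open>Y\<close>, then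
    \<open>f X\<close> lies above the image of \<open>{i}\<close> and \<open>f Y\<close> below the
    opposite coatom, so \<open>f X \<subseteq> f Y\<close> contradicts an assumed
    non-inclusion.\<close>
  have low: "1 \<in> X \<Longrightarrow> B \<subseteq> f X" "2 \<in> X \<Longrightarrow> C \<subseteq> f X"
    and high: "1 \<notin> X \<Longrightarrow> f X \<subseteq> C" "2 \<notin> X \<Longrightarrow> f X \<subseteq> B" for X
    using assms(1-4) by (simp_all add: f_def)
  have reflect: "X \<subseteq> Y" if XY: "X \<in> boolean_lattice 2" "f X \<subseteq> f Y" for X Y
  proof
    fix i
    assume "i \<in> X"
    moreover from this XY(1) have "i = 1 \<or> i = 2"
      unfolding Q by blast
    ultimately show "i \<in> Y"
      using low[of X] high[of Y] assms(5-6) XY(2) by blast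
  qed
  have "is_copy (boolean_lattice 2) (f ` boolean_lattice 2)"
    by (rule is_copy_image, rule iffI[OF mono reflect])
  moreover have "f ` boolean_lattice 2 = {A, B, C, D}"
    unfolding Q by (auto simp: f_def)
  ultimately show ?thesis by simp
qed

text \<open>Order reflection comes from the atoms not lying below their opposite coatoms:
  \<open>A1\<close> against \<open>B23\<close>, \<open>A2\<close> against \<open>B13\<close>,
  \<open>A3\<close> against \<open>B12\<close>.\<close>

lemma is_copy_boolean_lattice_3:
  fixes Z T :: "'a set"
  assumes "Z \<subseteq> A1" "Z \<subseteq> A2" "Z \<subseteq> A3"
    "A1 \<subseteq> B12" "A2 \<subseteq> B12" "A1 \<subseteq> B13" "A3 \<subseteq> B13" "A2 \<subseteq> B23" "A3 \<subseteq> B23"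
    "B12 \<subseteq> T" "B13 \<subseteq> T" "B23 \<subseteq> T" "\<not> A1 \<subseteq> B23" "\<not> A2 \<subseteq> B13" "\<not> A3 \<subseteq> B12"
  shows "is_copy (boolean_lattice 3) {Z, A1, A2, A3, B12, B13, B23, T}"
proof -
  define f where "f X =
    (if 1 \<in> X then if 2 \<in> X then if 3 \<in> X then T else B12 else if 3 \<in> X then B13 else A1
     else if 2 \<in> X then if 3 \<in> X then B23 else A2 else if 3 \<in> X then A3 else Z)"
    for X :: "nat set"
  have "{1..3::nat} = {1, 2, 3}" by auto
  then have Q: "boolean_lattice 3 = {{}, {1}, {2}, {3}, {1, 2}, {1, 3}, {2, 3}, {1, 2, 3}}"
    by (auto simp: boolean_lattice_def Pow_insert)
  have trans: "Z \<subseteq> B12" "Z \<subseteq> B13" "Z \<subseteq> B23" "Z \<subseteq> T" "A1 \<subseteq> T" "A2 \<subseteq> T" "A3 \<subseteq> T"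
    using assms(1-12) by blast+
  have mono: "f X \<subseteq> f Y" if "X \<subseteq> Y" for X Y
  proof -
    have "i \<in> Y" if "i \<in> X" for i
      using that \<open>X \<subseteq> Y\<close> by blast
    from this[of 1] this[of 2] this[of 3] show ?thesis
      using assms(1-12) trans unfolding f_def by (simp split: if_split)
  qed
  have low: "1 \<in> X \<Longrightarrow> A1 \<subseteq> f X" "2 \<in> X \<Longrightarrow> A2 \<subseteq> f X" "3 \<in> X \<Longrightarrow> A3 \<subseteq> f X"
    and high: "1 \<notin> X \<Longrightarrow> f X \<subseteq> B23" "2 \<notin> X \<Longrightarrow> f X \<subseteq> B13" "3 \<notin> X \<Longrightarrow> f X \<subseteq> B12" for X
    using assms(1-12) trans by (simp_all add: f_def)
  have reflect: "X \<subseteq> Y" if XY: "X \<in> boolean_lattice 3" "f X \<subseteq> f Y" for X Y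
  proof
    fix i
    assume "i \<in> X"
    moreover from this XY(1) have "i = 1 \<or> i = 2 \<or> i = 3"
      unfolding Q by blast
    ultimately show "i \<in> Y"
      using low[of X] high[of Y] assms(13-15) XY(2) by blast
  qed
  have "is_copy (boolean_lattice 3) (f ` boolean_lattice 3)"
    by (rule is_copy_image, rule iffI[OF mono reflect])
  moreover have "f ` boolean_lattice 3 = {Z, A1, A2, A3, B12, B13, B23, T}"
    unfolding Q by (auto simp: f_def)
  ultimately show ?thesis by simp
qed

lemma poset_arrows_5: "poset_arrows 5 (boolean_lattice 2) (boolean_lattice 3)"
  unfolding poset_arrows_def
proof (intro allI, rule ccontr)
  fix c :: "nat set \<Rightarrow> color"
  let ?V = "{1..5::nat}"
  assume no_copy: "\<not> ((\<exists>S\<subseteq>boolean_lattice 5. is_copy (boolean_lattice 2) S \<and> (\<forall>X\<in>S. c X = Red)) \<or>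
    (\<exists>S\<subseteq>boolean_lattice 5. is_copy (boolean_lattice 3) S \<and> (\<forall>X\<in>S. c X = Blue)))"
  have no_red: "\<not> (\<forall>X\<in>S. c X = Red)" if "S \<subseteq> Pow ?V" "is_copy (boolean_lattice 2) S" for S
    using no_copy that unfolding boolean_lattice_def[of 5] by blast
  have no_blue: "\<not> (\<forall>X\<in>S. c X = Blue)" if "S \<subseteq> Pow ?V" "is_copy (boolean_lattice 3) S" for S
    using no_copy that unfolding boolean_lattice_def[of 5] by blast
  have blue: "c X \<noteq> Red \<longleftrightarrow> c X = Blue" for X
    by (cases "c X") auto
  interpret no_mono_copy ?V "\<lambda>X. c X = Red"
  proof (unfold_locales, goal_cases)
    case (1 A B C D)
    then have "{A, B, C, D} \<subseteq> Pow ?V"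
      by auto
    from no_red[OF this is_copy_boolean_lattice_2] show ?case
      using 1 by auto
  next
    case (2 Z A1 A2 A3 B12 B13 B23 T)
    have "B12 \<subseteq> ?V" "B13 \<subseteq> ?V" "B23 \<subseteq> ?V"
      using 2(10-12,16) by blast+
    moreover from this have "A1 \<subseteq> ?V" "A2 \<subseteq> ?V" "A3 \<subseteq> ?V"
      using 2(4,5,7) by blast+
    moreover from this have "Z \<subseteq> ?V"
      using 2(1) by blast
    ultimately have "{Z, A1, A2, A3, B12, B13, B23, T} \<subseteq> Pow ?V"
      using 2(16) by blast
    from no_blue[OF this is_copy_boolean_lattice_3[OF 2(1-15)]] show ?case
      by (simp flip: blue)
  qed
  show False
    using card_neq_5 by simp
qed

section \<open>The lower bound, by lengths of chains\<close>

lemma is_copy_boolean_lattice_card: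
  assumes "is_copy (boolean_lattice k) S" "S \<subseteq> boolean_lattice n"
  obtains X Y where "X \<in> S" "Y \<in> S" "card X + k \<le> card Y"
proof -
  obtain f where f: "bij_betw f (boolean_lattice k) S"
    "\<forall>X\<in>boolean_lattice k. \<forall>Y\<in>boolean_lattice k. X \<subseteq> Y \<longleftrightarrow> f X \<subseteq> f Y"
    using assms(1) unfolding is_copy_def by blast
  have mem: "{1..i} \<in> boolean_lattice k" if "i \<le> k" for i
    using that by (auto simp: boolean_lattice_def)
  have S: "f {1..i} \<in> S" if "i \<le> k" for i
    using f(1) mem[OF that] by (auto dest: bij_betwE)
  \<comment> \<open>The images of \<open>{1..0} = {}\<close>, \<open>{1..1}\<close>, and so on form
    a strict chain of finite sets, so each step adds at least one element.\<close>
  have "card (f {1..0}) + i \<le> card (f {1..i})" if "i \<le> k" for i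
    using that
  proof (induction i)
    case (Suc i)
    have "f {1..i} \<subset> f {1..Suc i}"
      using f(2)[rule_format, of "{1..i}" "{1..Suc i}"] f(2)[rule_format, of "{1..Suc i}" "{1..i}"]
        mem Suc.prems by auto
    moreover have "f {1..Suc i} \<subseteq> {1..n}"
      using S[OF Suc.prems] assms(2) by (auto simp: boolean_lattice_def)
    then have "finite (f {1..Suc i})"
      using finite_subset by blast
    ultimately have "card (f {1..i}) < card (f {1..Suc i})"
      by (simp add: psubset_card_mono)
    then show ?case
      using Suc by simp
  qed simp
  then show thesis
    using that[of "f {1..0}" "f {1..k}"] S by blast
qed

lemma not_poset_arrows:
  assumes "n < 5"
  shows "\<not> poset_arrows n (boolean_lattice 2) (boolean_lattice 3)"
proof
  assume arrows: "poset_arrows n (boolean_lattice 2) (boolean_lattice 3)"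
  \<comment> \<open>Red sizes are at most 1, blue sizes lie between 2 and \<open>n \<le> 4\<close>.
    The differences are at most 1 and 2, short of the 2 and 3 that the copies require.\<close>
  define c where "c X = (if card X \<le> 1 then Red else Blue)" for X :: "nat set"
  consider
      S where "S \<subseteq> boolean_lattice n" "is_copy (boolean_lattice 2) S" "\<forall>X\<in>S. c X = Red"
    | S where "S \<subseteq> boolean_lattice n" "is_copy (boolean_lattice 3) S" "\<forall>X\<in>S. c X = Blue"
    using spec[OF arrows[unfolded poset_arrows_def], of c] by blast
  then show False
  proof cases
    case 1
    then obtain X Y where "X \<in> S" "Y \<in> S" "card X + 2 \<le> card Y"
      by (meson is_copy_boolean_lattice_card)
    with 1(3) show False
      by (force simp: c_def split: if_splits)
  next
    case 2
    then obtain X Y where XY: "X \<in> S" "Y \<in> S" "card X + 3 \<le> card Y"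
      by (meson is_copy_boolean_lattice_card)
    have "card Y \<le> n"
      using XY(2) 2(1) card_mono[of "{1..n}" Y] by (auto simp: boolean_lattice_def)
    moreover have "card X \<ge> 2"
      using XY(1) 2(3) by (force simp: c_def split: if_splits)
    ultimately show False
      using XY(3) assms by simp
  qed
qed

theorem theorem8:
  shows "poset_ramsey (boolean_lattice 2) (boolean_lattice 3) = 5"
  unfolding poset_ramsey_def
proof (rule cInf_eq_minimum)
  show "5 \<in> {N. poset_arrows N (boolean_lattice 2) (boolean_lattice 3)}"
    by (simp add: poset_arrows_5)
  show "5 \<le> n" if "n \<in> {N. poset_arrows N (boolean_lattice 2) (boolean_lattice 3)}" for n
    using that not_poset_arrows[of n] by (cases "n < 5") auto
qed

end
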